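(* $\mathcal{E}(\mathcal{M}\cap\mathcal{N})\cap\mathrm{Perf}=\mathfrak{P}_2\cap\mathrm{Perf}$.
   Context: $2^\omega$ is the Cantor space with its standard product probability measure, $[\omega]^\omega$ is the family of infinite subsets of $\omega$, and $\mathrm{Perf}$ is the class of all perfect subsets of $2^\omega$ (closed sets without isolated points). $\mathcal{M}$ and $\mathcal{N}$ are the $\sigma$-ideals of meager and of null subsets of $2^\omega$. For $S\in[\omega]^\omega$ with increasing enumeration $S=\{s_0<s_1<\dots\}$, let $\tilde s:2^\omega\to 2^S$ be the bijection $\tilde s(x)(s_i)=x(i)$; for a $\sigma$-ideal $\mathcal{I}$ on $2^\omega$ and $A\subseteq 2^S$ let $A\in\mathcal{I}(2^S)$ iff $\tilde s^{-1}[A]\in\mathcal{I}$. For $X\subseteq 2^\omega$, $X\restriction S=\{x\restriction S:x\in X\}\subseteq 2^S$. Define $\mathcal{E}(\mathcal{I})=\{X\subseteq 2^\omega:(\forall S\in[\omega]^\omega)\ X\restriction S\in\mathcal{I}(2^S)\}$, used here for $\mathcal{I}=\mathcal{M}\cap\mathcal{N}$, and $\mathfrak{P}_2=\{X\subseteq 2^\omega:(\forall S\in[\omega]^\omega)\ X\restriction S\neq 2^S\}$. *)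

theory Defs
  imports "HOL-Analysis.Analysis" "HOL-Library.Infinite_Set"
begin

text \<open>
  Points of the Cantor space are functions \<open>nat \<Rightarrow> bool\<close>; the topology is the
  library's product topology on the function type, with \<open>bool\<close> discrete.
\<close>

type_synonym cantor = "nat \<Rightarrow> bool"

definition cantor_measure :: "cantor measure" where
  "cantor_measure = (\<Pi>\<^sub>M i\<in>UNIV. uniform_count_measure UNIV)"

definition nowhere_dense :: "'a::topological_space set \<Rightarrow> bool" where
  "nowhere_dense A \<longleftrightarrow> interior (closure A) = {}"

definition meager_sets :: "cantor set set" where
  "meager_sets = {X. \<exists>F :: nat \<Rightarrow> cantor set. (\<forall>n. nowhere_dense (F n)) \<and> X \<subseteq> (\<Union>n. F n)}"

text \<open>The completion makes this all subsets of measurable sets of measure zero.\<close>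

definition negligible_sets :: "cantor set set" where
  "negligible_sets = null_sets (completion cantor_measure)"

text \<open>The empty set counts as perfect.\<close>

definition Perf :: "cantor set set" where
  "Perf = {X. closed X \<and> (\<forall>x\<in>X. \<not> x isolated_in X)}"

text \<open>
  Elements of \<open>2\<^sup>S\<close> are represented by the functions that take the value \<open>undefined\<close> outside \<open>S\<close>.
\<close>

definition two_pow :: "nat set \<Rightarrow> cantor set" where
  "two_pow S = S \<rightarrow>\<^sub>E UNIV"

definition restr :: "cantor set \<Rightarrow> nat set \<Rightarrow> cantor set" where
  "restr X S = (\<lambda>x. restrict x S) ` X"

text \<open>
  For infinite \<open>S\<close>, \<open>enumerate S\<close> is the increasing enumeration of \<open>S\<close>;
  \<open>tilde S\<close> is the induced bijection from the Cantor space onto \<open>2\<^sup>S\<close>.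
\<close>

definition tilde :: "nat set \<Rightarrow> cantor \<Rightarrow> cantor" where
  "tilde S x = (\<lambda>n\<in>S. x (inv (enumerate S) n))"

lemma tilde_enumerate:
  assumes "infinite S"
  shows "tilde S x (enumerate S i) = x i"
proof -
  have "inj (enumerate S)"
    using bij_enumerate[OF assms] by (simp add: bij_betw_def)
  then show ?thesis
    using enumerate_in_set[OF assms] by (simp add: tilde_def)
qed

lemma bij_betw_tilde:
  assumes "infinite S"
  shows "bij_betw (tilde S) UNIV (two_pow S)"
proof (rule bij_betw_byWitness[where f' = "\<lambda>y i. y (enumerate S i)"])
  show "\<forall>x\<in>UNIV. (\<lambda>i. tilde S x (enumerate S i)) = x"
    by (simp add: tilde_enumerate[OF assms])
  show "\<forall>y\<in>two_pow S. tilde S (\<lambda>i. y (enumerate S i)) = y"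
  proof
    fix y assume y: "y \<in> two_pow S"
    have "range (enumerate S) = S"
      using bij_enumerate[OF assms] by (simp add: bij_betw_def)
    then show "tilde S (\<lambda>i. y (enumerate S i)) = y"
      using y by (auto simp: tilde_def two_pow_def fun_eq_iff f_inv_into_f restrict_def PiE_def
          extensional_def)
  qed
  show "range (tilde S) \<subseteq> two_pow S"
    by (auto simp: tilde_def two_pow_def)
  show "(\<lambda>y i. y (enumerate S i)) ` two_pow S \<subseteq> UNIV"
    by simp
qed

definition ideal_on :: "cantor set set \<Rightarrow> nat set \<Rightarrow> cantor set set" where
  "ideal_on I S = {A. A \<subseteq> two_pow S \<and> tilde S -` A \<in> I}"

definition E_class :: "cantor set set \<Rightarrow> cantor set set" where
  "E_class I = {X. \<forall>S. infinite S \<longrightarrow> restr X S \<in> ideal_on I S}"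

definition P2_class :: "cantor set set" where
  "P2_class = {X. \<forall>S. infinite S \<longrightarrow> restr X S \<noteq> two_pow S}"

end

theory Submission
  imports Defs "HOL-Probability.Infinite_Product_Measure"
begin

text \<open>
  One inclusion holds because the whole Cantor space has measure one: a set whose restrictions
  are all null cannot restrict onto any \<open>2\<^sup>S\<close>.

  For the other inclusion, let \<open>X\<close> be perfect. By compactness every
  restriction of \<open>X\<close> is closed, and a closed null set is nowhere dense, since nonempty open sets
  have positive measure. So it is enough that each restriction is null. Suppose that the copy
  \<open>K\<close> of \<open>X \<restriction> S\<close> in the Cantor space is not null. Then \<open>K\<close> restricts
  onto \<open>2\<^sup>T\<close> for some infinite \<open>T\<close> (\<open>positive_measure_full_restriction\<close>), so that \<open>X\<close>
  restricts onto \<open>2\<^sup>S\<^sup>'\<close>, where \<open>S'\<close> is the set of those elements of \<open>S\<close> whose index is in \<open>T\<close>.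

  The set \<open>T\<close> is built one coordinate at a time, so that every prescription of values on the
  coordinates chosen so far is attained on a part of \<open>K\<close> of positive measure. A new coordinate
  exists because a set \<open>A\<close> of positive measure is, up to a null set, constant at only finitely many
  coordinates (\<open>finite_constant_coordinates\<close>): being constant at \<open>n\<close> coordinates
  forces measure at most \<open>2\<^sup>-\<^sup>n\<close>. Compactness of \<open>K\<close> then passes from the finite stages to \<open>T\<close>.
\<close>

section \<open>Cylinders in the Cantor space\<close>

definition cylinder :: "nat set \<Rightarrow> cantor \<Rightarrow> cantor set" where
  "cylinder J x = {y. \<forall>j\<in>J. y j = x j}"

lemma prob_space_fair_coin: "prob_space (uniform_count_measure (UNIV :: bool set))"
  by (rule prob_space_uniform_count_measure) auto

lemma product_prob_space_fair_coin:
  "product_prob_space (\<lambda>i::nat. uniform_count_measure (UNIV :: bool set))"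
  by (rule product_prob_spaceI) (rule prob_space_fair_coin)

lemma prob_space_cantor_measure: "prob_space cantor_measure"
  unfolding cantor_measure_def by (rule prob_space_PiM) (rule prob_space_fair_coin)

lemma space_cantor_measure: "space cantor_measure = UNIV"
  by (simp add: cantor_measure_def space_PiM space_uniform_count_measure PiE_UNIV_domain)

text \<open>
  Needed to identify the product \<open>\<sigma>\<close>-algebra with the Borel sets of the product topology.
\<close>

instance bool :: second_countable_topology
proof
  show "\<exists>B::bool set set. countable B \<and> open = generate_topology B"
    by (intro exI[of _ "range lessThan \<union> range greaterThan"]) (auto simp: open_bool_def)
qed

lemma sets_cantor_measure: "sets cantor_measure = sets borel"
proof -
  have "sets cantor_measure = sets (\<Pi>\<^sub>M i\<in>(UNIV::nat set). (borel :: bool measure))"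
    unfolding cantor_measure_def
    by (rule sets_PiM_cong) (simp_all add: sets_uniform_count_measure sets_borel_eq_count_space)
  then show ?thesis
    using sets_PiM_equal_borel by simp
qed

lemma closed_in_sets_cantor_measure: "closed K \<Longrightarrow> K \<in> sets cantor_measure"
  by (simp add: sets_cantor_measure)

lemma emeasure_cylinder:
  assumes "finite J"
  shows "emeasure cantor_measure (cylinder J x) = ennreal ((1/2) ^ card J)"
proof -
  interpret product_prob_space "\<lambda>i::nat. uniform_count_measure (UNIV :: bool set)" UNIV
    by (rule product_prob_space_fair_coin)
  have "emeasure cantor_measure (cylinder J x)
      = (\<Prod>j\<in>J. emeasure (uniform_count_measure UNIV) {x j})"
    using emeasure_PiM_Collect[of J "\<lambda>j. {x j}"] assms space_cantor_measure
    by (simp add: cantor_measure_def cylinder_def sets_uniform_count_measure)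
  also have "\<dots> = (\<Prod>j\<in>J. ennreal (1/2))"
    by (simp add: emeasure_uniform_count_measure)
  also have "\<dots> = ennreal ((1/2) ^ card J)"
    by (simp only: prod_constant ennreal_power)
  finally show ?thesis .
qed

lemma closed_cylinder: "closed (cylinder J x)"
proof -
  have "cylinder J x = (\<Inter>j\<in>J. (\<lambda>y. y j) -` {x j})"
    by (auto simp: cylinder_def)
  moreover have "closed ((\<lambda>y::cantor. y j) -` {x j})" for j
    by (intro closed_vimage continuous_on_product_coordinates closed_singleton)
  ultimately show ?thesis
    by auto
qed

lemma open_contains_cylinder:
  assumes "open U" "x \<in> U"
  obtains J where "finite J" "cylinder J x \<subseteq> U"
proof -
  have "openin (product_topology (\<lambda>i. euclidean) UNIV) U"
    using assms(1) by (simp add: open_fun_def)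
  from product_topology_open_contains_basis[OF this assms(2)]
  obtain V where V: "x \<in> Pi\<^sub>E UNIV V" "finite {i. V i \<noteq> UNIV}" "Pi\<^sub>E UNIV V \<subseteq> U"
    by auto
  have "cylinder {i. V i \<noteq> UNIV} x \<subseteq> Pi\<^sub>E UNIV V"
  proof
    fix y assume y: "y \<in> cylinder {i. V i \<noteq> UNIV} x"
    have "y i \<in> V i" for i
    proof (cases "V i = UNIV")
      case False
      then have "y i = x i"
        using y by (simp add: cylinder_def)
      then show ?thesis
        using V(1) by (simp add: PiE_iff)
    qed simp
    then show "y \<in> Pi\<^sub>E UNIV V"
      by auto
  qed
  with V(3) show thesis
    by (intro that[OF V(2)]) (rule subset_trans)
qed

lemma compact_UNIV_cantor: "compact (UNIV :: cantor set)"
proof -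
  have "compact_space (euclidean :: bool topology)"
    by (simp add: compact_space_def finite_imp_compact)
  then have "compact_space (product_topology (\<lambda>i::nat. euclidean :: bool topology) UNIV)"
    by (simp only: compact_space_product_topology) blast
  then show ?thesis
    by (simp add: compact_space_def euclidean_product_topology)
qed

text \<open>
  The Cantor space is Hausdorff, as a product of Hausdorff spaces.
\<close>

lemma compact_imp_closed_cantor:
  fixes K :: "cantor set"
  assumes "compact K"
  shows "closed K"
proof -
  have "Hausdorff_space (euclidean :: bool topology)"
    unfolding Hausdorff_space_def disjnt_def using hausdorff[where 'a = bool] by simp
  then have "Hausdorff_space (euclidean :: cantor topology)"
    unfolding euclidean_product_topology[symmetric] Hausdorff_space_product_topology by simp
  then show ?thesis
    using compactin_imp_closedin[of euclidean K] assms by simp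
qed

section \<open>Closed null sets\<close>

text \<open>
  An interior point would bring a whole cylinder, hence positive measure, into \<open>K\<close>.
\<close>

lemma null_set_imp_nowhere_dense:
  assumes "closed K" "K \<in> null_sets cantor_measure"
  shows "nowhere_dense K"
proof -
  have "x \<notin> interior K" for x
  proof
    assume "x \<in> interior K"
    then obtain J where J: "finite J" "cylinder J x \<subseteq> interior K"
      using open_contains_cylinder by blast
    have "emeasure cantor_measure (cylinder J x) \<le> emeasure cantor_measure K"
      using J interior_subset[of K] closed_in_sets_cantor_measure[OF assms(1)]
      by (intro emeasure_mono) blast+
    also have "\<dots> = 0"
      using assms(2) by (rule null_setsD1)
    finally show False
      using J by (simp add: emeasure_cylinder)
  qed
  then have "interior K = {}"
    by blast
  then show ?thesis
    using assms(1) by (simp add: nowhere_dense_def closure_closed)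
qed

section \<open>Closed sets of positive measure\<close>

text \<open>
  If the value \<open>b\<close> is almost never taken at the coordinates of a set \<open>F\<close> of size \<open>n\<close>, then \<open>A\<close>
  lies, up to a null set, in the cylinder of the points that are constantly \<open>\<not> b\<close> on \<open>F\<close>. That
  cylinder has measure \<open>2\<^sup>-\<^sup>n\<close>, so \<open>n\<close> cannot be arbitrarily large.
\<close>

lemma finite_constant_coordinates:
  assumes A: "A \<in> sets cantor_measure" "A \<notin> null_sets cantor_measure"
  shows "finite {t. A \<inter> {y. y t = b} \<in> null_sets cantor_measure}" (is "finite ?B")
proof (rule ccontr)
  assume inf: "infinite ?B"
  let ?c = "\<lambda>_::nat. \<not> b"
  have "emeasure cantor_measure A \<le> ennreal ((1/2) ^ n)" for n
  proof -
    obtain F where F: "F \<subseteq> ?B" "finite F" "card F = n"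
      using infinite_arbitrarily_large[OF inf, of n] by blast
    have N: "(\<Union>t\<in>F. A \<inter> {y. y t = b}) \<in> null_sets cantor_measure"
      using F by (intro null_sets_UN' countable_finite) auto
    have C: "cylinder F ?c \<in> sets cantor_measure"
      by (intro closed_in_sets_cantor_measure closed_cylinder)
    have "emeasure cantor_measure A
        \<le> emeasure cantor_measure (cylinder F ?c \<union> (\<Union>t\<in>F. A \<inter> {y. y t = b}))"
      using C N by (intro emeasure_mono) (auto simp: cylinder_def null_setsD2 intro!: sets.Un)
    also have "\<dots> = emeasure cantor_measure (cylinder F ?c)"
      using C N by (rule emeasure_Un_null_set)
    finally show ?thesis
      using F by (simp add: emeasure_cylinder)
  qed
  moreover have "(\<lambda>n. ennreal ((1/2) ^ n)) \<longlonglongrightarrow> ennreal 0"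
    by (intro tendsto_ennrealI LIMSEQ_power_zero) simp
  ultimately have "emeasure cantor_measure A \<le> ennreal 0"
    by (intro LIMSEQ_le_const) auto
  then show False
    using A by (simp add: null_sets_def)
qed

text \<open>
  The invariant of the construction of \<open>T\<close>. Asking merely that \<open>K\<close> meets each cylinder would not
  allow the next step: a nonempty null piece may be constant at all further coordinates.
\<close>

definition splits :: "cantor set \<Rightarrow> nat set \<Rightarrow> bool" where
  "splits K T \<longleftrightarrow> (\<forall>x. K \<inter> cylinder T x \<notin> null_sets cantor_measure)"

text \<open>
  Only finitely many pieces of \<open>K\<close> arise from prescriptions on \<open>T\<close>, and each of them excludes
  finitely many coordinates, so some coordinate outside \<open>T\<close> splits all the pieces at once.
\<close>

lemma splits_extend:
  assumes "closed K" "finite T" "splits K T"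
  obtains t where "t \<notin> T" "splits K (insert t T)"
proof -
  let ?bad = "\<lambda>x b. {t. (K \<inter> cylinder T x) \<inter> {y. y t = b} \<in> null_sets cantor_measure}"
  \<comment> \<open>A prescription on \<open>T\<close> is an extensional function, which makes their number finite.\<close>
  let ?P = "T \<rightarrow>\<^sub>E (UNIV :: bool set)"
  have "finite (?bad x b)" for x b
  proof (rule finite_constant_coordinates)
    show "K \<inter> cylinder T x \<in> sets cantor_measure"
      by (intro closed_in_sets_cantor_measure closed_Int assms(1) closed_cylinder)
    show "K \<inter> cylinder T x \<notin> null_sets cantor_measure"
      using assms(3) by (simp add: splits_def)
  qed
  moreover have "finite ?P"
    using assms by (intro finite_PiE) auto
  ultimately have "finite (T \<union> (\<Union>x\<in>?P. \<Union>b. ?bad x b))"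
    using assms by simp
  then obtain t where t: "t \<notin> T \<union> (\<Union>x\<in>?P. \<Union>b. ?bad x b)"
    using ex_new_if_finite[OF infinite_UNIV_nat] by blast
  have "K \<inter> cylinder (insert t T) x \<notin> null_sets cantor_measure" for x
  proof -
    have "restrict x T \<in> ?P"
      by simp
    with t have "t \<notin> ?bad (restrict x T) (x t)"
      by blast
    moreover have "K \<inter> cylinder T (restrict x T) \<inter> {y. y t = x t} = K \<inter> cylinder (insert t T) x"
      by (auto simp: cylinder_def)
    ultimately show ?thesis
      by simp
  qed
  with t show thesis
    using that by (auto simp: splits_def)
qed

text \<open>
  The stages \<open>T n\<close> of the construction have size \<open>n\<close>, so their union is infinite. To realise
  \<open>x\<close> on the union, note that finitely many of the constraints all belong to one stage, where they
  are realised in \<open>K\<close>; compactness realises all of them together.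
\<close>

lemma positive_measure_full_restriction:
  assumes "closed K" "K \<notin> null_sets cantor_measure"
  obtains T where "infinite T" "\<And>x. K \<inter> cylinder T x \<noteq> {}"
proof -
  have "\<exists>T. \<forall>n. (finite (T n) \<and> card (T n) = n \<and> splits K (T n)) \<and> T n \<subseteq> T (Suc n)"
  proof (rule dependent_nat_choice)
    show "\<exists>T. finite T \<and> card T = 0 \<and> splits K T"
      using assms by (intro exI[of _ "{}"]) (simp add: splits_def cylinder_def)
  next
    fix T n assume T: "finite T \<and> card T = n \<and> splits K T"
    then obtain t where "t \<notin> T" "splits K (insert t T)"
      by (auto elim: splits_extend[OF assms(1), of T])
    with T show "\<exists>T'. (finite T' \<and> card T' = Suc n \<and> splits K T') \<and> T \<subseteq> T'"
      by (intro exI[of _ "insert t T"]) auto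
  qed
  then obtain T where T: "\<And>n. finite (T n)" "\<And>n. card (T n) = n" "\<And>n. splits K (T n)"
      "\<And>n. T n \<subseteq> T (Suc n)"
    by blast
  have mono: "mono T"
    using T(4) by (simp add: mono_iff_le_Suc)
  show thesis
  proof (rule that)
    show "infinite (\<Union>n. T n)"
    proof
      assume fin: "finite (\<Union>n. T n)"
      have "card (T (Suc (card (\<Union>n. T n)))) \<le> card (\<Union>n. T n)"
        using fin by (intro card_mono) auto
      then show False
        using T(2) by simp
    qed
  next
    fix x
    have "K \<inter> (\<Inter>t\<in>(\<Union>n. T n). cylinder {t} x) \<noteq> {}"
    proof (rule compact_imp_fip_image)
      show "compact K"
        using compact_Int_closed[OF compact_UNIV_cantor assms(1)] by simp
    next
      fix F assume F: "finite F" "F \<subseteq> (\<Union>n. T n)"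
      have "\<exists>n. F \<subseteq> T n"
        using F
      proof (induction F)
        case (insert t F)
        then obtain m n where "t \<in> T m" "F \<subseteq> T n"
          by auto
        moreover have "T m \<subseteq> T (max m n)" "T n \<subseteq> T (max m n)"
          by (rule monoD[OF mono], simp)+
        ultimately have "insert t F \<subseteq> T (max m n)"
          by auto
        then show ?case ..
      qed auto
      then obtain n where n: "F \<subseteq> T n" ..
      have "K \<inter> cylinder (T n) x \<noteq> {}"
      proof
        assume "K \<inter> cylinder (T n) x = {}"
        then have "K \<inter> cylinder (T n) x \<in> null_sets cantor_measure"
          by (simp add: null_sets_def)
        with T(3)[of n] show False
          by (simp add: splits_def)
      qed
      then obtain y where "y \<in> K" "y \<in> cylinder (T n) x"
        by blast
      with n have "y \<in> K \<inter> (\<Inter>t\<in>F. cylinder {t} x)"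
        by (auto simp: cylinder_def)
      then show "K \<inter> (\<Inter>t\<in>F. cylinder {t} x) \<noteq> {}"
        by blast
    qed (rule closed_cylinder)
    then show "K \<inter> cylinder (\<Union>n. T n) x \<noteq> {}"
      by (auto simp: cylinder_def)
  qed
qed

section \<open>Restrictions to infinite sets of coordinates\<close>

text \<open>
  The copy of \<open>X \<restriction> S\<close> in the Cantor space is an image of \<open>X\<close> under a continuous map, the
  reindexing along the enumeration of \<open>S\<close>.
\<close>

lemma tilde_vimage_restr:
  assumes "infinite S"
  shows "tilde S -` restr X S = (\<lambda>x i. x (enumerate S i)) ` X"
proof -
  have "tilde S y = restrict x S \<longleftrightarrow> y = (\<lambda>i. x (enumerate S i))" for x y
  proof
    assume "tilde S y = restrict x S"
    then show "y = (\<lambda>i. x (enumerate S i))"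
      using tilde_enumerate[OF assms, of y] enumerate_in_set[OF assms] by auto
  next
    assume y: "y = (\<lambda>i. x (enumerate S i))"
    have "range (enumerate S) = S"
      using bij_enumerate[OF assms] by (simp add: bij_betw_def)
    then show "tilde S y = restrict x S"
      by (simp add: y tilde_def f_inv_into_f cong: restrict_cong)
  qed
  then show ?thesis
    by (auto simp: restr_def)
qed

lemma closed_tilde_vimage_restr:
  assumes "infinite S" "closed X"
  shows "closed (tilde S -` restr X S)"
proof -
  have "compact X"
    using compact_Int_closed[OF compact_UNIV_cantor assms(2)] by simp
  moreover have "continuous_on X (\<lambda>x i. x (enumerate S i))"
    by (intro continuous_on_coordinatewise_then_product
      continuous_on_subset[OF continuous_on_product_coordinates]) simp
  ultimately show ?thesis
    unfolding tilde_vimage_restr[OF assms(1)]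
    by (intro compact_imp_closed_cantor compact_continuous_image)
qed

lemma tilde_vimage_two_pow:
  assumes "infinite S"
  shows "tilde S -` two_pow S = UNIV"
  using bij_betw_tilde[OF assms] by (auto simp: bij_betw_def)

lemma restr_eq_two_pow:
  assumes "\<And>x. X \<inter> cylinder S x \<noteq> {}"
  shows "restr X S = two_pow S"
proof
  show "restr X S \<subseteq> two_pow S"
    by (auto simp: restr_def two_pow_def)
  show "two_pow S \<subseteq> restr X S"
  proof
    fix x assume x: "x \<in> two_pow S"
    obtain y where "y \<in> X" "y \<in> cylinder S x"
      using assms by blast
    moreover from this x have "x = restrict y S"
      by (auto simp: cylinder_def two_pow_def PiE_def extensional_def restrict_def)
    ultimately show "x \<in> restr X S"
      by (auto simp: restr_def)
  qed
qed

text \<open>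
  Otherwise the copy of \<open>X \<restriction> S\<close> restricts onto \<open>2\<^sup>T\<close> for some infinite set \<open>T\<close> of indices.
  Translated back by the enumeration of \<open>S\<close>, this says that \<open>X\<close> restricts onto the power
  belonging to the image of \<open>T\<close>.
\<close>

lemma closed_P2_null_restriction:
  assumes "closed X" "X \<in> P2_class" "infinite S"
  shows "tilde S -` restr X S \<in> null_sets cantor_measure" (is "?K \<in> _")
proof (rule ccontr)
  assume "?K \<notin> null_sets cantor_measure"
  then obtain T where T: "infinite T" "\<And>x. ?K \<inter> cylinder T x \<noteq> {}"
    using positive_measure_full_restriction[OF closed_tilde_vimage_restr[OF assms(3,1)]] by metis
  let ?S' = "enumerate S ` T"
  have "inj (enumerate S)"
    using bij_enumerate[OF assms(3)] by (simp add: bij_betw_def)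
  then have "infinite ?S'"
    using T(1) finite_imageD inj_on_subset by blast
  moreover have "restr X ?S' = two_pow ?S'"
  proof (rule restr_eq_two_pow)
    fix x
    show "X \<inter> cylinder ?S' x \<noteq> {}"
      using T(2)[of "\<lambda>i. x (enumerate S i)"]
      by (auto simp: tilde_vimage_restr[OF assms(3)] cylinder_def)
  qed
  ultimately show False
    using assms(2) by (auto simp: P2_class_def)
qed

lemma E_class_subset_P2_class:
  "E_class (meager_sets \<inter> negligible_sets) \<subseteq> P2_class"
proof
  fix X assume X: "X \<in> E_class (meager_sets \<inter> negligible_sets)"
  have "restr X S \<noteq> two_pow S" if S: "infinite S" for S
  proof
    assume "restr X S = two_pow S"
    then have "UNIV \<in> negligible_sets"
      using X S by (auto simp: E_class_def ideal_on_def tilde_vimage_two_pow)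
    moreover have "emeasure (completion cantor_measure) UNIV = 1"
      using prob_space.emeasure_space_1[OF prob_space_cantor_measure]
      by (simp add: space_cantor_measure emeasure_completion sets_cantor_measure)
    ultimately show False
      by (auto simp: negligible_sets_def null_sets_def)
  qed
  then show "X \<in> P2_class"
    by (simp add: P2_class_def)
qed

lemma closed_P2_class_imp_E_class:
  assumes "closed X" "X \<in> P2_class"
  shows "X \<in> E_class (meager_sets \<inter> negligible_sets)"
proof -
  have "restr X S \<in> ideal_on (meager_sets \<inter> negligible_sets) S" if S: "infinite S" for S
  proof -
    let ?K = "tilde S -` restr X S"
    have null: "?K \<in> null_sets cantor_measure"
      using assms S by (rule closed_P2_null_restriction)
    then have "nowhere_dense ?K"
      using closed_tilde_vimage_restr[OF S assms(1)] by (intro null_set_imp_nowhere_dense)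
    then have "?K \<in> meager_sets"
      unfolding meager_sets_def by (intro CollectI exI[of _ "\<lambda>_. ?K"]) auto
    moreover have "?K \<in> negligible_sets"
      using null by (simp add: negligible_sets_def null_sets_completion_iff null_setsD2)
    ultimately show ?thesis
      by (auto simp: ideal_on_def restr_def two_pow_def)
  qed
  then show ?thesis
    by (simp add: E_class_def)
qed

theorem corollary3p6:
  shows "E_class (meager_sets \<inter> negligible_sets) \<inter> Perf = P2_class \<inter> Perf"
  using E_class_subset_P2_class closed_P2_class_imp_E_class by (auto simp: Perf_def)

end
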